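(* Let $r=2$, $\lambda>0$, $L=\begin{bmatrix}0&1\\-\lambda&0\end{bmatrix}$, $\Delta t=T/N$. Denote by $\{(\bm k_n,\bm z_n)\}_n$, with $\bm k_n=[\bm k_{1,n},\bm k_{2,n},\bm k_{3,n}]^\top$, the sequence produced by the 3-stage Lobatto IIIC Runge–Kutta scheme applied to $\dot{\bm z}=L\bm z$ with step $\Delta t$ starting from $\bm z_0\in\mathbb{R}^2$, and by $\{\widehat{\bm z}_n\}_n$ the sequence generated by the DG1 scheme $$(I_3\otimes I_2-N^4\otimes L)\,\widehat{\bm z}_{n+1}=-(N^5\otimes I_2)\,\widehat{\bm z}_n$$ starting from $\widehat{\bm z}_0\in\mathbb{R}^6$, with $N^4,N^5$ as in the context. If $[\widehat{\bm z}_0]_{5,6}=\bm z_0$, then $$[\widehat{\bm z}_n]_{5,6}=\bm z_n\quad\text{and}\quad\widehat{\bm z}_n=(I_3\otimes L^{-1})\,\bm k_{n-1}\qquad\text{for }n=1,\dots,N.$$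
   Context: $\otimes$ is the Kronecker product; $[\bm x]_{5,6}$ is the vector of the fifth and sixth components of $\bm x$. Runge–Kutta scheme: $\bm k_{i,n}=L\bigl(\bm z_n+\Delta t\sum_{j}a_{ij}\bm k_{j,n}\bigr)$, $\bm z_{n+1}=\bm z_n+\Delta t\sum_ib_i\bm k_{i,n}$, the stages being stacked in $\bm k_n\in\mathbb{R}^6$. The 3-stage Lobatto IIIC method has $A=\begin{bmatrix}1/6&-1/3&1/6\\1/6&5/12&-1/12\\1/6&2/3&1/6\end{bmatrix}$, $\bm b=(1/6,2/3,1/6)$, $\bm c=(0,1/2,1)$. DG1 scheme: with $t_n=n\Delta t$, $I_n=(t_{n-1},t_n]$, let $\psi_{n,1},\psi_{n,2},\psi_{n,3}$ be the Lagrange basis of $\mathbb{P}^2(I_n)$ at the nodes $t_{n-1},\frac12(t_{n-1}+t_n),t_n$; $N^0_{ij}=-\psi_{n,j}(t_n)\psi_{n+1,i}(t_n)$, $N^1_{ij}=\int_{I_{n+1}}\dot\psi_{n+1,j}\psi_{n+1,i}$, $N^2_{ij}=\int_{I_{n+1}}\psi_{n+1,j}\psi_{n+1,i}$, $N^3_{ij}=\psi_{n+1,j}(t_n)\psi_{n+1,i}(t_n)$, where the integrals are computed with the 3-point Gauss–Legendre–Lobatto quadrature (reference nodes $\{-1,0,1\}$, weights $\{1/3,4/3,1/3\}$ on $[-1,1]$); $N^4=(N^1+N^3)^{-1}N^2$, $N^5=(N^1+N^3)^{-1}N^0$ (superscripts are labels). Explicitly $N^4=\Delta t\,A=\Delta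 t\begin{bmatrix}1/6&-1/3&1/6\\1/6&5/12&-1/12\\1/6&2/3&1/6\end{bmatrix}$, and $N^5=\begin{bmatrix}0&0&-1\\0&0&-1\\0&0&-1\end{bmatrix}$. *)

theory Defs
  imports "HOL-Analysis.Analysis" "HOL-Computational_Algebra.Polynomial"
begin

text \<open>
  The space \<open>\<real>\<^sup>6\<close> of three stacked vectors of \<open>\<real>\<^sup>2\<close> is \<^typ>\<open>real^(3 \<times> 2)\<close>. The index
  \<open>(i, j)\<close>, with \<open>i\<close> in \<open>1, 2, 3\<close> and \<open>j\<close> in \<open>1, 2\<close>, stands for the component number
  \<open>2 (i - 1) + j\<close> (lexicographic order), so that components 5 and 6 are \<open>(3, 1)\<close> and \<open>(3, 2)\<close>,
  and the Kronecker product has its usual block structure.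
\<close>

definition kronecker :: "'a::times^'n::finite^'m::finite \<Rightarrow> 'a^'q::finite^'p::finite \<Rightarrow> 'a^('n \<times> 'q)^('m \<times> 'p)"
    (infixl "\<otimes>\<^sub>K" 75)
  where "A \<otimes>\<^sub>K B = (\<chi> r c. A $ fst r $ fst c * B $ snd r $ snd c)"

definition block :: "'m::finite \<Rightarrow> 'a^('m \<times> 'p::finite) \<Rightarrow> 'a^'p"
  where "block i x = (\<chi> j. x $ (i, j))"

definition comps_5_6 :: "real^(3 \<times> 2) \<Rightarrow> real^2"
  where "comps_5_6 x = vector [x $ (3, 1), x $ (3, 2)]"

definition L_mat :: "real \<Rightarrow> real^2^2"
  where "L_mat lam = vector [vector [0, 1], vector [- lam, 0]]"


text \<open>One step from \<open>z\<close> to \<open>z'\<close> of a Runge--Kutta scheme for the system \<open>dz/dt = L z\<close> (autonomous, so the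
  abscissae \<open>c\<close> play no role); \<open>k\<close> is the stack of the stages. The scheme may be implicit, so
  this is a relation.\<close>

definition rk_step ::
    "real^'s^'s \<Rightarrow> real^'s \<Rightarrow> real^'d^'d \<Rightarrow> real \<Rightarrow> real^'d \<Rightarrow> real^('s::finite \<times> 'd::finite) \<Rightarrow> real^'d \<Rightarrow> bool"
  where "rk_step A b L dt z k z' \<longleftrightarrow>
    (\<forall>i. block i k = L *v (z + dt *\<^sub>R (\<Sum>j\<in>UNIV. (A $ i $ j) *\<^sub>R block j k))) \<and>
    z' = z + dt *\<^sub>R (\<Sum>i\<in>UNIV. (b $ i) *\<^sub>R block i k)"

definition lobatto_IIIC_A :: "real^3^3"
  where "lobatto_IIIC_A = vector
    [vector [1/6, -1/3,  1/6],
     vector [1/6, 5/12, -1/12],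
     vector [1/6,  2/3,  1/6]]"

definition lobatto_IIIC_b :: "real^3"
  where "lobatto_IIIC_b = vector [1/6, 2/3, 1/6]"


text \<open>Time steps are indexed by integers because the interval \<open>I\<^sub>0 = (- dt, 0]\<close> occurs in the
  first step of the DG scheme.\<close>

definition time_grid :: "real \<Rightarrow> int \<Rightarrow> real"
  where "time_grid dt n = of_int n * dt"

definition dg_node :: "real \<Rightarrow> int \<Rightarrow> real^3"
  where "dg_node dt n = vector
    [time_grid dt (n - 1), (time_grid dt (n - 1) + time_grid dt n) / 2, time_grid dt n]"

definition lagrange_basis :: "real^'n \<Rightarrow> 'n::finite \<Rightarrow> real poly"
  where "lagrange_basis x j = (\<Prod>m\<in>UNIV - {j}. smult (1 / (x $ j - x $ m)) [:- x $ m, 1:])"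

definition dg_basis :: "real \<Rightarrow> int \<Rightarrow> 3 \<Rightarrow> real poly"
  where "dg_basis dt n = lagrange_basis (dg_node dt n)"

definition gll_node :: "real^3"
  where "gll_node = vector [-1, 0, 1]"

definition gll_weight :: "real^3"
  where "gll_weight = vector [1/3, 4/3, 1/3]"

text \<open>Three-point Gauss--Legendre--Lobatto approximation of the integral of \<open>f\<close> over \<open>[a, b]\<close>,
  obtained from the rule on \<open>[-1, 1]\<close> by the affine change of variables.\<close>

definition gll_quadrature :: "real \<Rightarrow> real \<Rightarrow> (real \<Rightarrow> real) \<Rightarrow> real"
  where "gll_quadrature a b f =
    (b - a) / 2 * (\<Sum>q\<in>UNIV. gll_weight $ q * f ((a + b) / 2 + (b - a) / 2 * gll_node $ q))"

definition dg_N0 :: "real \<Rightarrow> int \<Rightarrow> real^3^3"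
  where "dg_N0 dt n = (\<chi> i j.
    - (poly (dg_basis dt n j) (time_grid dt n) * poly (dg_basis dt (n + 1) i) (time_grid dt n)))"

definition dg_N1 :: "real \<Rightarrow> int \<Rightarrow> real^3^3"
  where "dg_N1 dt n = (\<chi> i j. gll_quadrature (time_grid dt n) (time_grid dt (n + 1))
    (\<lambda>t. poly (pderiv (dg_basis dt (n + 1) j)) t * poly (dg_basis dt (n + 1) i) t))"

definition dg_N2 :: "real \<Rightarrow> int \<Rightarrow> real^3^3"
  where "dg_N2 dt n = (\<chi> i j. gll_quadrature (time_grid dt n) (time_grid dt (n + 1))
    (\<lambda>t. poly (dg_basis dt (n + 1) j) t * poly (dg_basis dt (n + 1) i) t))"

definition dg_N3 :: "real \<Rightarrow> int \<Rightarrow> real^3^3"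
  where "dg_N3 dt n = (\<chi> i j.
    poly (dg_basis dt (n + 1) j) (time_grid dt n) * poly (dg_basis dt (n + 1) i) (time_grid dt n))"

definition dg_N4 :: "real \<Rightarrow> int \<Rightarrow> real^3^3"
  where "dg_N4 dt n = matrix_inv (dg_N1 dt n + dg_N3 dt n) ** dg_N2 dt n"

definition dg_N5 :: "real \<Rightarrow> int \<Rightarrow> real^3^3"
  where "dg_N5 dt n = matrix_inv (dg_N1 dt n + dg_N3 dt n) ** dg_N0 dt n"

definition dg_step ::
    "real^2^2 \<Rightarrow> real \<Rightarrow> nat \<Rightarrow> real^(3 \<times> 2) \<Rightarrow> real^(3 \<times> 2) \<Rightarrow> bool"
  where "dg_step L dt n x x' \<longleftrightarrow>
    ((mat 1 :: real^3^3) \<otimes>\<^sub>K (mat 1 :: real^2^2) - dg_N4 dt (int n) \<otimes>\<^sub>K L) *v x' =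
    - (dg_N5 dt (int n) \<otimes>\<^sub>K (mat 1 :: real^2^2)) *v x"


text \<open>The matrices of the DG scheme do not depend on \<open>n\<close>; they are computed here explicitly.\<close>

lemma UNIV_3_minus: "(UNIV::3 set) - {1} = {2,3}" "(UNIV::3 set) - {2} = {1,3}"
  "(UNIV::3 set) - {3} = {1,2}"
  unfolding UNIV_3 by auto

lemma lagrange_basis_equispaced:
  fixes a h s :: real
  assumes "h \<noteq> 0" and x: "x = (vector [a, a + h / 2, a + h] :: real^3)"
  shows "poly (lagrange_basis x 1) (a + s * h) = (1 - s) * (1 - 2 * s)"
    and "poly (lagrange_basis x 2) (a + s * h) = 4 * s * (1 - s)"
    and "poly (lagrange_basis x 3) (a + s * h) = s * (2 * s - 1)"
    and "poly (pderiv (lagrange_basis x 1)) (a + s * h) = (4 * s - 3) / h"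
    and "poly (pderiv (lagrange_basis x 2)) (a + s * h) = (4 - 8 * s) / h"
    and "poly (pderiv (lagrange_basis x 3)) (a + s * h) = (4 * s - 1) / h"
proof -
  have p: "lagrange_basis x 1 = smult (- 2 / h) [:- (a + h / 2), 1:] * smult (- 1 / h) [:- (a + h), 1:]"
    "lagrange_basis x 2 = smult (2 / h) [:- a, 1:] * smult (- 2 / h) [:- (a + h), 1:]"
    "lagrange_basis x 3 = smult (1 / h) [:- a, 1:] * smult (2 / h) [:- (a + h / 2), 1:]"
    by (simp_all add: lagrange_basis_def UNIV_3_minus x
        del: mult_pCons_left mult_pCons_right smult_pCons mult_smult_left mult_smult_right)
  show "poly (lagrange_basis x 1) (a + s * h) = (1 - s) * (1 - 2 * s)"
    "poly (lagrange_basis x 2) (a + s * h) = 4 * s * (1 - s)"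
    "poly (lagrange_basis x 3) (a + s * h) = s * (2 * s - 1)"
    "poly (pderiv (lagrange_basis x 1)) (a + s * h) = (4 * s - 3) / h"
    "poly (pderiv (lagrange_basis x 2)) (a + s * h) = (4 - 8 * s) / h"
    "poly (pderiv (lagrange_basis x 3)) (a + s * h) = (4 * s - 1) / h"
    using assms(1) unfolding p poly_mult pderiv_mult poly_add pderiv_smult poly_smult pderiv_pCons
    by (simp_all add: field_simps)
qed

lemma poly_dg_basis:
  assumes "dt \<noteq> 0"
  defines "s \<equiv> \<lambda>n t. t / dt - (of_int n - 1)"
  shows "poly (dg_basis dt n 1) t = (1 - s n t) * (1 - 2 * s n t)"
    and "poly (dg_basis dt n 2) t = 4 * s n t * (1 - s n t)"
    and "poly (dg_basis dt n 3) t = s n t * (2 * s n t - 1)"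
    and "poly (pderiv (dg_basis dt n 1)) t = (4 * s n t - 3) / dt"
    and "poly (pderiv (dg_basis dt n 2)) t = (4 - 8 * s n t) / dt"
    and "poly (pderiv (dg_basis dt n 3)) t = (4 * s n t - 1) / dt"
proof -
  define a where "a = (of_int n - 1) * dt"
  have x: "dg_node dt n = vector [a, a + dt / 2, a + dt]"
    by (simp add: dg_node_def time_grid_def a_def field_simps)
  have t: "a + s n t * dt = t"
    using assms(1) by (simp add: s_def a_def field_simps)
  note l = lagrange_basis_equispaced[OF assms(1) x, of "s n t", unfolded t]
  show "poly (dg_basis dt n 1) t = (1 - s n t) * (1 - 2 * s n t)"
    "poly (dg_basis dt n 2) t = 4 * s n t * (1 - s n t)"
    "poly (dg_basis dt n 3) t = s n t * (2 * s n t - 1)"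
    "poly (pderiv (dg_basis dt n 1)) t = (4 * s n t - 3) / dt"
    "poly (pderiv (dg_basis dt n 2)) t = (4 - 8 * s n t) / dt"
    "poly (pderiv (dg_basis dt n 3)) t = (4 * s n t - 1) / dt"
    unfolding dg_basis_def by (fact l)+
qed

lemma dg_N0_explicit:
  assumes "dt \<noteq> 0"
  shows "dg_N0 dt n = vector [vector [0, 0, -1], vector [0, 0, 0], vector [0, 0, 0]]"
  using assms by (simp add: vec_eq_iff forall_3 dg_N0_def poly_dg_basis time_grid_def)

lemma dg_N2_explicit:
  assumes "dt \<noteq> 0"
  shows "dg_N2 dt n = dt *\<^sub>R vector [vector [1/6, 0, 0], vector [0, 2/3, 0], vector [0, 0, 1/6]]"
  using assms
  by (simp add: vec_eq_iff forall_3 dg_N2_def poly_dg_basis time_grid_def gll_quadrature_def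
      gll_weight_def gll_node_def sum_3 add_divide_distrib diff_divide_distrib distrib_right)

lemma dg_N1_N3_explicit:
  assumes "dt \<noteq> 0"
  shows "dg_N1 dt n + dg_N3 dt n =
    vector [vector [1/2, 2/3, -1/6], vector [-2/3, 0, 2/3], vector [1/6, -2/3, 1/2]]"
  using assms
  by (simp add: vec_eq_iff forall_3 dg_N1_def dg_N3_def poly_dg_basis time_grid_def gll_quadrature_def
      gll_weight_def gll_node_def sum_3 add_divide_distrib diff_divide_distrib distrib_right)

lemma matrix_inv_eqI:
  fixes M :: "real^'n^'n"
  assumes "M ** B = mat 1" and "B ** M = mat 1"
  shows "matrix_inv M = B"
proof -
  have "M ** matrix_inv M = mat 1 \<and> matrix_inv M ** M = mat 1"
    unfolding matrix_inv_def by (rule someI[of _ B]) (use assms in simp)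
  then have "matrix_inv M = matrix_inv M ** (M ** B)"
    using assms by simp
  also have "\<dots> = B"
    using \<open>_ \<and> _\<close> by (simp add: matrix_mul_assoc)
  finally show ?thesis .
qed

lemma matrix_inv_dg_N1_N3:
  assumes "dt \<noteq> 0"
  shows "matrix_inv (dg_N1 dt n + dg_N3 dt n) =
    vector [vector [1, -1/2, 1], vector [1, 5/8, -1/2], vector [1, 1, 1]]"
  unfolding dg_N1_N3_explicit[OF assms]
  by (rule matrix_inv_eqI)
    (simp_all add: vec_eq_iff forall_3 matrix_matrix_mult_def sum_3 mat_def)

lemma dg_N4_explicit:
  assumes "dt \<noteq> 0"
  shows "dg_N4 dt n = dt *\<^sub>R lobatto_IIIC_A"
  unfolding dg_N4_def matrix_inv_dg_N1_N3[OF assms] dg_N2_explicit[OF assms]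
  by (simp add: vec_eq_iff forall_3 matrix_matrix_mult_def sum_3 lobatto_IIIC_A_def)

lemma dg_N5_explicit:
  assumes "dt \<noteq> 0"
  shows "dg_N5 dt n = vector [vector [0, 0, -1], vector [0, 0, -1], vector [0, 0, -1]]"
  unfolding dg_N5_def matrix_inv_dg_N1_N3[OF assms] dg_N0_explicit[OF assms]
  by (simp add: vec_eq_iff forall_3 matrix_matrix_mult_def sum_3)

end

theory Submission
  imports Defs
begin

text \<open>
  Write \<open>g\<^sub>1, g\<^sub>2, g\<^sub>3 \<in> \<real>\<^sup>2\<close> for the three blocks of a vector of \<open>\<real>\<^sup>6\<close>. Since \<open>N\<^sup>4 = \<Delta>t A\<close> and \<open>-N\<^sup>5\<close>
  copies the last block of the previous step into every row, one step of the DG scheme says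
  \<open>g\<^sub>i = z + \<Delta>t \<Sum>\<^sub>j a\<^sub>i\<^sub>j L g\<^sub>j\<close>, where \<open>z\<close> is that last block. The Runge--Kutta stages satisfy
  \<open>k\<^sub>i = L (z + \<Delta>t \<Sum>\<^sub>j a\<^sub>i\<^sub>j k\<^sub>j)\<close>, so the vectors \<open>L\<^sup>-\<^sup>1 k\<^sub>i\<close>, the stage values, solve the very same
  system. Two facts remain.

  First, this system has only one solution (lemma \<open>stage_values_unique\<close>). With \<open>M = N\<^sup>1 + N\<^sup>3\<close>, which
  satisfies \<open>M A = diag b\<close>, the difference \<open>u\<close> of two solutions obeys
  \<open>\<Sum>\<^sub>j M\<^sub>i\<^sub>j u\<^sub>j = \<Delta>t b\<^sub>i L u\<^sub>i\<close>. Pair row \<open>i\<close> with \<open>u\<^sub>i\<close> in the energy form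
  \<open>q(v, w) = \<lambda> v\<^sub>1 w\<^sub>1 + v\<^sub>2 w\<^sub>2\<close> and add up. The oscillator \<open>L\<close> conserves energy, \<open>q(v, L v) = 0\<close>, so the
  right-hand side vanishes; the symmetric part of \<open>M\<close> is \<open>diag(1/2, 0, 1/2)\<close> (the discrete form of
  integration by parts: only the jump at the left end and the value at the right end survive), so
  \<open>q(u\<^sub>1, u\<^sub>1) + q(u\<^sub>3, u\<^sub>3) = 0\<close>. Hence \<open>u\<^sub>1 = u\<^sub>3 = 0\<close>, and rows 1 and 3 then give \<open>u\<^sub>2 = 0\<close>.

  Second, the scheme is stiffly accurate: the last row of \<open>A\<close> is \<open>b\<close>, so the third stage value is
  \<open>z\<^sub>n\<^sub>+\<^sub>1\<close> (lemma \<open>rk_step_stage_values\<close>). The third block of the DG solution is thus again the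
  Runge--Kutta solution, and induction on \<open>n\<close> applies.
\<close>

lemma block_eqI:
  assumes "\<And>i. block i x = block i y"
  shows "x = y"
  using assms by (auto simp: block_def vec_eq_iff)

lemma block_diff: "block i (x - y) = block i x - block i (y :: real^('m::finite \<times> 'p::finite))"
  by (simp add: block_def vec_eq_iff)

lemma comps_5_6_eq_block: "comps_5_6 x = block 3 x"
  by (simp add: comps_5_6_def block_def vec_eq_iff forall_2)

lemma block_kronecker:
  fixes A :: "real^'n^'m" and B :: "real^'q^'p" and x :: "real^('n::finite \<times> 'q::finite)"
  shows "block i ((A \<otimes>\<^sub>K B) *v x) = B *v (\<Sum>j\<in>UNIV. A $ i $ j *\<^sub>R block j x)"
proof -
  have "(\<Sum>c\<in>UNIV. A $ i $ fst c * B $ r $ snd c * x $ c)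
      = (\<Sum>s\<in>UNIV. B $ r $ s * (\<Sum>j\<in>UNIV. A $ i $ j * x $ (j, s)))" for r
  proof -
    have "(\<Sum>c\<in>UNIV. A $ i $ fst c * B $ r $ snd c * x $ c)
        = (\<Sum>j\<in>UNIV. \<Sum>s\<in>UNIV. A $ i $ j * B $ r $ s * x $ (j, s))"
      by (simp add: sum.cartesian_product case_prod_unfold)
    also have "\<dots> = (\<Sum>s\<in>UNIV. \<Sum>j\<in>UNIV. A $ i $ j * B $ r $ s * x $ (j, s))"
      by (rule sum.swap)
    finally show ?thesis
      by (simp add: sum_distrib_left mult_ac)
  qed
  then show ?thesis
    by (simp add: vec_eq_iff block_def kronecker_def matrix_vector_mult_def)
qed

lemma block_mat_1_kronecker:
  fixes B :: "real^'q^'p" and x :: "real^('n::finite \<times> 'q::finite)"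
  shows "block i (((mat 1 :: real^'n^'n) \<otimes>\<^sub>K B) *v x) = B *v block i x"
  by (simp add: block_kronecker mat_def if_distrib[of "\<lambda>a. a *\<^sub>R _"] sum.delta cong: if_cong)

text \<open>This is the energy estimate. It works for any \<open>f\<close> that conserves some positive definite
  quadratic energy: when row \<open>i\<close> of \<open>N\<^sup>1 + N\<^sup>3\<close> is paired with \<open>u\<^sub>i\<close> and the rows are added, the mixed
  terms cancel because the off-diagonal part of that matrix is skew-symmetric.\<close>

lemma lobatto_homogeneous_zero:
  fixes f :: "real^'d \<Rightarrow> real^'d" and q :: "real^'d \<Rightarrow> real^'d \<Rightarrow> real" and u :: "3 \<Rightarrow> real^'d"
  assumes q: "bilinear q" and sym: "\<And>v w. q v w = q w v" and pos: "\<And>v. v \<noteq> 0 \<Longrightarrow> q v v > 0"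
    and conservative: "\<And>v. q v (f v) = 0"
    and u: "\<And>i. u i = dt *\<^sub>R (\<Sum>j\<in>UNIV. lobatto_IIIC_A $ i $ j *\<^sub>R f (u j))"
  shows "u i = 0"
proof -
  have u': "u i $ d = dt * (\<Sum>j\<in>UNIV. lobatto_IIIC_A $ i $ j * f (u j) $ d)" for i d
    using arg_cong[OF u[of i], of "\<lambda>v. v $ d"] by simp
  have c: "u 1 $ d = dt * (f (u 1) $ d / 6 - f (u 2) $ d / 3 + f (u 3) $ d / 6)"
    "u 2 $ d = dt * (f (u 1) $ d / 6 + 5 * f (u 2) $ d / 12 - f (u 3) $ d / 12)"
    "u 3 $ d = dt * (f (u 1) $ d / 6 + 2 * f (u 2) $ d / 3 + f (u 3) $ d / 6)" for d
    by (subst u', simp add: sum_3 lobatto_IIIC_A_def)+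
  \<comment> \<open>The stage equations multiplied by \<open>N\<^sup>1 + N\<^sup>3\<close>, which turns \<open>A\<close> into \<open>diag(1/6, 2/3, 1/6)\<close>.\<close>
  have M: "(1/2) *\<^sub>R u 1 + (2/3) *\<^sub>R u 2 - (1/6) *\<^sub>R u 3 = (dt / 6) *\<^sub>R f (u 1)"
    "- (2/3) *\<^sub>R u 1 + (2/3) *\<^sub>R u 3 = (2 * dt / 3) *\<^sub>R f (u 2)"
    "(1/6) *\<^sub>R u 1 - (2/3) *\<^sub>R u 2 + (1/2) *\<^sub>R u 3 = (dt / 6) *\<^sub>R f (u 3)"
    by (simp_all add: vec_eq_iff c algebra_simps)
  note expand = bilinear_radd[OF q] bilinear_rsub[OF q] bilinear_rmul[OF q] conservative
  have "q (u 1) (u 1) / 2 + 2 * q (u 1) (u 2) / 3 - q (u 1) (u 3) / 6 = 0"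
    using arg_cong[OF M(1), of "q (u 1)"] by (simp add: expand)
  moreover have "- 2 * q (u 2) (u 1) / 3 + 2 * q (u 2) (u 3) / 3 = 0"
    using arg_cong[OF M(2), of "q (u 2)"] by (simp only: expand) simp
  moreover have "q (u 3) (u 1) / 6 - 2 * q (u 3) (u 2) / 3 + q (u 3) (u 3) / 2 = 0"
    using arg_cong[OF M(3), of "q (u 3)"] by (simp add: expand)
  ultimately have "q (u 1) (u 1) + q (u 3) (u 3) = 0"
    using sym[of "u 2" "u 1"] sym[of "u 3" "u 1"] sym[of "u 3" "u 2"] by linarith
  moreover have "q v v \<ge> 0" for v
    using pos[of v] bilinear_lzero[OF q, of 0] by (cases "v = 0") auto
  ultimately have "q (u 1) (u 1) = 0" "q (u 3) (u 3) = 0"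
    by (smt (verit))+
  then have u13: "u 1 = 0" "u 3 = 0"
    using pos by force+
  have "u 2 = 0"
  proof -
    \<comment> \<open>Rows 1 and 3 have the same right-hand side once \<open>u\<^sub>1 = u\<^sub>3\<close>, and opposite coefficients of \<open>u\<^sub>2\<close>.\<close>
    have "(2/3) *\<^sub>R u 2 = - ((2/3) *\<^sub>R u 2)"
      using M(1,3) u13 by simp
    then show ?thesis by simp
  qed
  then show ?thesis
    using u13 exhaust_3[of i] by auto
qed

lemma L_mat_mult: "L_mat lam *v v = vector [v $ 2, - lam * v $ 1]"
  by (simp add: L_mat_def vec_eq_iff forall_2 matrix_vector_mult_def sum_2)

text \<open>The energy \<open>\<lambda> x\<^sup>2 + v\<^sup>2\<close> of the oscillator \<open>x' = v, v' = -\<lambda> x\<close> is what excludes a nonzero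
  difference of two solutions, for any step size.\<close>

lemma stage_values_unique:
  fixes x y :: "real^(3 \<times> 2)"
  assumes "lam > 0"
    and x: "\<And>i. block i x = z + dt *\<^sub>R (\<Sum>j\<in>UNIV. lobatto_IIIC_A $ i $ j *\<^sub>R (L_mat lam *v block j x))"
    and y: "\<And>i. block i y = z + dt *\<^sub>R (\<Sum>j\<in>UNIV. lobatto_IIIC_A $ i $ j *\<^sub>R (L_mat lam *v block j y))"
  shows "x = y"
proof -
  define q :: "real^2 \<Rightarrow> real^2 \<Rightarrow> real" where "q v w = lam * v $ 1 * w $ 1 + v $ 2 * w $ 2" for v w
  have "bilinear q"
    by (auto simp: bilinear_def q_def algebra_simps intro!: linearI)
  moreover have "q v w = q w v" for v w
    by (simp add: q_def)
  moreover have "q v v > 0" if "v \<noteq> 0" for v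
  proof -
    have "v $ 1 \<noteq> 0 \<or> v $ 2 \<noteq> 0"
      using that by (auto simp: vec_eq_iff forall_2)
    then show ?thesis
      using \<open>lam > 0\<close> by (auto simp: q_def mult.assoc intro: add_pos_nonneg add_nonneg_pos
          simp flip: power2_eq_square)
  qed
  moreover have "q v (L_mat lam *v v) = 0" for v
    by (simp add: q_def L_mat_mult)
  moreover have "block i (x - y) = dt *\<^sub>R (\<Sum>j\<in>UNIV. lobatto_IIIC_A $ i $ j *\<^sub>R (L_mat lam *v block j (x - y)))" for i
    unfolding block_diff
    by (subst x, subst y)
      (simp add: matrix_vector_mult_diff_distrib scaleR_diff_right sum_subtractf)
  ultimately have "block i (x - y) = 0" for i
    by (rule lobatto_homogeneous_zero)
  then show ?thesis
    by (intro block_eqI) (simp add: block_diff)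
qed

lemma matrix_inv_L_mat:
  assumes "lam \<noteq> 0"
  shows "matrix_inv (L_mat lam) ** L_mat lam = mat 1" and "L_mat lam ** matrix_inv (L_mat lam) = mat 1"
proof -
  define B :: "real^2^2" where "B = vector [vector [0, - 1 / lam], vector [1, 0]]"
  have "L_mat lam ** B = mat 1" "B ** L_mat lam = mat 1"
    using assms by (simp_all add: B_def L_mat_def vec_eq_iff forall_2 matrix_matrix_mult_def sum_2 mat_def)
  moreover from this have "matrix_inv (L_mat lam) = B"
    by (rule matrix_inv_eqI)
  ultimately show "matrix_inv (L_mat lam) ** L_mat lam = mat 1" "L_mat lam ** matrix_inv (L_mat lam) = mat 1"
    by simp_all
qed

text \<open>Every row of \<open>-N\<^sup>5\<close> is \<open>(0, 0, 1)\<close>, so only the last block of the old DG vector enters, and it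
  enters all three equations in the same way, as the starting value of a Runge--Kutta step does.\<close>

lemma dg_step_stage_system:
  assumes "dt \<noteq> 0" and step: "dg_step L dt n x x'"
  shows "block i x' = comps_5_6 x + dt *\<^sub>R (\<Sum>j\<in>UNIV. lobatto_IIIC_A $ i $ j *\<^sub>R (L *v block j x'))"
proof -
  have "((mat 1 :: real^3^3) \<otimes>\<^sub>K (mat 1 :: real^2^2)) *v x' - ((dt *\<^sub>R lobatto_IIIC_A) \<otimes>\<^sub>K L) *v x'
      = - (dg_N5 dt (int n) \<otimes>\<^sub>K (mat 1 :: real^2^2)) *v x"
    using step by (simp add: dg_step_def dg_N4_explicit[OF assms(1)] matrix_vector_mult_diff_rdistrib)
  then have "((mat 1 :: real^3^3) \<otimes>\<^sub>K (mat 1 :: real^2^2)) *v x' - ((dt *\<^sub>R lobatto_IIIC_A) \<otimes>\<^sub>K L) *v x'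
      = 0 - (dg_N5 dt (int n) \<otimes>\<^sub>K (mat 1 :: real^2^2)) *v x"
    by (simp add: vec_eq_iff matrix_vector_mult_def sum_negf)
  from arg_cong[OF this, of "block i"]
  have "block i x' - dt *\<^sub>R (\<Sum>j\<in>UNIV. lobatto_IIIC_A $ i $ j *\<^sub>R (L *v block j x')) =
      block i 0 - (\<Sum>j\<in>UNIV. dg_N5 dt (int n) $ i $ j *\<^sub>R block j x)"
    unfolding block_diff block_mat_1_kronecker matrix_vector_mul_lid
    unfolding block_kronecker matrix_vector_mul_lid
    by (simp add: matrix_vector_mult_scaleR linear_sum[OF matrix_vector_mul_linear] scaleR_sum_right)
  also have "\<dots> = comps_5_6 x"
    using exhaust_3[of i]
    by (auto simp: dg_N5_explicit[OF assms(1)] sum_3 comps_5_6_eq_block block_def vec_eq_iff)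
  finally show ?thesis
    by (simp add: algebra_simps)
qed

text \<open>Since \<open>k\<^sub>i\<close> is \<open>L\<close> applied to the stage value, \<open>L\<^sup>-\<^sup>1 k\<^sub>i\<close> recovers that value. The second
  claim is stiff accuracy: the last row of \<open>A\<close> equals \<open>b\<close>, so the last stage value and the update
  are the same expression.\<close>

lemma rk_step_stage_values:
  fixes z :: "real^2"
  assumes "lam \<noteq> 0"
    and step: "rk_step lobatto_IIIC_A lobatto_IIIC_b (L_mat lam) dt z k z'"
  defines "w \<equiv> ((mat 1 :: real^3^3) \<otimes>\<^sub>K matrix_inv (L_mat lam)) *v k"
  shows "block i w = z + dt *\<^sub>R (\<Sum>j\<in>UNIV. lobatto_IIIC_A $ i $ j *\<^sub>R (L_mat lam *v block j w))"
    and "block 3 w = z'"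
proof -
  have w: "block i w = matrix_inv (L_mat lam) *v block i k" for i
    by (simp add: w_def block_mat_1_kronecker)
  have k: "L_mat lam *v block i w = block i k" for i
    by (simp add: w matrix_vector_mul_assoc matrix_inv_L_mat[OF assms(1)])
  have stage: "block i w = z + dt *\<^sub>R (\<Sum>j\<in>UNIV. lobatto_IIIC_A $ i $ j *\<^sub>R block j k)" for i
  proof -
    have "block i k = L_mat lam *v (z + dt *\<^sub>R (\<Sum>j\<in>UNIV. lobatto_IIIC_A $ i $ j *\<^sub>R block j k))"
      using step unfolding rk_step_def by blast
    from arg_cong[OF this, of "\<lambda>v. matrix_inv (L_mat lam) *v v"] show ?thesis
      by (simp only: w matrix_vector_mul_assoc matrix_inv_L_mat(1)[OF assms(1)] matrix_vector_mul_lid)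
  qed
  then show "block i w = z + dt *\<^sub>R (\<Sum>j\<in>UNIV. lobatto_IIIC_A $ i $ j *\<^sub>R (L_mat lam *v block j w))"
    unfolding k .
  have "lobatto_IIIC_A $ 3 = lobatto_IIIC_b"
    by (simp add: lobatto_IIIC_A_def lobatto_IIIC_b_def)
  then show "block 3 w = z'"
    using stage[of 3] step unfolding rk_step_def by metis
qed

theorem corollary10:
  fixes T lam dt :: real and N :: nat
    and z :: "nat \<Rightarrow> real^2"
    and k :: "nat \<Rightarrow> real^(3 \<times> 2)"
    and zh :: "nat \<Rightarrow> real^(3 \<times> 2)"
  assumes "T > 0" and "N \<ge> 1" and "dt = T / real N"
    and "lam > 0"
    and "\<forall>n<N. rk_step lobatto_IIIC_A lobatto_IIIC_b (L_mat lam) dt (z n) (k n) (z (Suc n))"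
    and "\<forall>n<N. dg_step (L_mat lam) dt n (zh n) (zh (Suc n))"
    and "comps_5_6 (zh 0) = z 0"
  shows "\<forall>n\<in>{1..N}. comps_5_6 (zh n) = z n \<and>
    zh n = ((mat 1 :: real^3^3) \<otimes>\<^sub>K matrix_inv (L_mat lam)) *v k (n - 1)"
proof -
  have "dt \<noteq> 0" and "lam \<noteq> 0"
    using assms by auto
  have step: "zh (Suc n) = ((mat 1 :: real^3^3) \<otimes>\<^sub>K matrix_inv (L_mat lam)) *v k n"
      "comps_5_6 (zh (Suc n)) = z (Suc n)"
    if "n < N" and z: "comps_5_6 (zh n) = z n" for n
  proof -
    have rk: "rk_step lobatto_IIIC_A lobatto_IIIC_b (L_mat lam) dt (z n) (k n) (z (Suc n))"
      and dg: "dg_step (L_mat lam) dt n (zh n) (zh (Suc n))"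
      using assms \<open>n < N\<close> by blast+
    show zh: "zh (Suc n) = ((mat 1 :: real^3^3) \<otimes>\<^sub>K matrix_inv (L_mat lam)) *v k n"
      by (rule stage_values_unique[OF \<open>lam > 0\<close> dg_step_stage_system[OF \<open>dt \<noteq> 0\<close> dg, unfolded z]
            rk_step_stage_values(1)[OF \<open>lam \<noteq> 0\<close> rk]])
    show "comps_5_6 (zh (Suc n)) = z (Suc n)"
      unfolding zh comps_5_6_eq_block by (rule rk_step_stage_values(2)[OF \<open>lam \<noteq> 0\<close> rk])
  qed
  have "comps_5_6 (zh n) = z n" if "n \<le> N" for n
    using that by (induction n) (use assms(7) step(2) in simp_all)
  moreover have "zh n = ((mat 1 :: real^3^3) \<otimes>\<^sub>K matrix_inv (L_mat lam)) *v k (n - 1)"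
    if "n \<in> {1..N}" for n
  proof -
    have "n - 1 < N" "Suc (n - 1) = n"
      using that by auto
    then show ?thesis
      using calculation[of "n - 1"] step(1)[of "n - 1"] by simp
  qed
  ultimately show ?thesis
    by (meson atLeastAtMost_iff)
qed

end
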